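(* Let $S$ be a set, $D\subset\mathbb{R}$ an interval, $\rho:S\times S\to D$ a symmetric function, and $m\ge 2$ an integer. Let $X$ and $Y$ be two subsets of $S$ of cardinality $m$ such that $R_\rho(X)\vartriangleright R_\rho(Y)$. Then for every convex decreasing function $f:D\to\mathbb{R}$ we have $E_f(X)\le E_f(Y)$.
   Context: For a finite real sequence $A=(a_1,\dots,a_N)$ let $a_{(1)}\le a_{(2)}\le\dots\le a_{(N)}$ be its elements arranged in non-decreasing order. For two real sequences $A,B$ of the same length $N$, write $A\vartriangleright B$ ("$A$ majorizes $B$") if $a_{(1)}+\dots+a_{(k)}\ge b_{(1)}+\dots+b_{(k)}$ for all $k=1,\dots,N$. (The total sums need not be equal.) For $X=\{x_1,\dots,x_m\}\subset S$, $R_\rho(X)$ denotes the sequence, of length $m(m-1)/2$ (values listed with repetition), of the numbers $\rho(x_i,x_j)$, $1\le i<j\le m$; and $E_f(X):=\sum_{1\le i<j\le m} f(\rho(x_i,x_j))$. *)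

theory Defs
  imports "HOL-Analysis.Analysis"
begin

text \<open>Majorization compares partial sums of the smallest entries, and the total sums
  may differ. As \<open>sort\<close> is non-decreasing, \<open>sort A ! i\<close> is the entry $a_{(i+1)}$.\<close>

definition majorizes :: "real list \<Rightarrow> real list \<Rightarrow> bool" (infix "\<rhd>" 50) where
  "A \<rhd> B \<longleftrightarrow> length A = length B \<and>
     (\<forall>k\<in>{1..length A}. (\<Sum>i<k. sort A ! i) \<ge> (\<Sum>i<k. sort B ! i))"

text \<open>An $m$-element set $X = \{x_1,\dots,x_m\}$ is given by an enumeration \<open>x\<close>
  with \<open>bij_betw x {1..m} X\<close>. For symmetric \<open>\<rho>\<close>, a different enumeration of the same set
  only permutes the list \<open>R_seq\<close>, which affects neither majorization nor the energy.\<close>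

definition R_seq :: "('s \<Rightarrow> 's \<Rightarrow> real) \<Rightarrow> nat \<Rightarrow> (nat \<Rightarrow> 's) \<Rightarrow> real list" where
  "R_seq \<rho> m x = [\<rho> (x i) (x j). i \<leftarrow> [1..<Suc m], j \<leftarrow> [Suc i..<Suc m]]"

definition energy :: "('s \<Rightarrow> 's \<Rightarrow> real) \<Rightarrow> (real \<Rightarrow> real) \<Rightarrow> nat \<Rightarrow> (nat \<Rightarrow> 's) \<Rightarrow> real" where
  "energy \<rho> f m x = (\<Sum>(i, j)\<in>{(i, j). 1 \<le> i \<and> i < j \<and> j \<le> m}. f (\<rho> (x i) (x j)))"

end

theory Submission
  imports Defs
begin

text \<open>
  This is the weak majorization inequality of Tomic and Weyl. Write the two lists of values in
  sorted order as $a_1 \le \dots \le a_N$ and $b_1 \le \dots \le b_N$. If $f$ has a subgradient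
  $c_i$ at each $a_i$, then $f(b_i) - f(a_i) \ge c_i (b_i - a_i)$, so it is enough that
  $\sum_i c_i (b_i - a_i) \ge 0$. The $c_i$ are non-decreasing because $f$ is convex and
  non-positive because $f$ is decreasing, while majorization says that all partial sums of
  $b_i - a_i$ are non-positive; summation by parts (\<open>sum_mult_nonneg_by_parts\<close>) then gives
  the claim. The last boundary term of that summation is $c_N \sum_i (b_i - a_i)$; it vanishes
  when the total sums agree, and in general the sign of $c_N$ makes it non-negative. The energy of
  a point set is the sum of $f$ over its list of pairwise values (\<open>energy_eq_sum_list\<close>).

  A convex function on an interval may fail to have a subgradient at an endpoint, for instance at
  a point where it jumps. But only finitely many points occur here, and on a finite set the least
  secant slope to the right, capped at $0$, serves as a non-positive subgradient
  (\<open>finite_nonpos_subgradient\<close>).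
\<close>

text \<open>
  At the largest point of \<open>P\<close> there is no slope to the right, and the value $0$ still works there
  because \<open>f\<close> decreases. Elsewhere convexity puts every slope to the left of \<open>t\<close> below
  every slope to its right.
\<close>

lemma finite_nonpos_subgradient:
  fixes f :: "real \<Rightarrow> real"
  assumes "convex_on D f" and "antimono_on D f" and "finite P" and "P \<subseteq> D"
  obtains g where "\<And>t. g t \<le> 0"
    and "\<And>s t. s \<in> P \<Longrightarrow> t \<in> P \<Longrightarrow> g t * (s - t) \<le> f s - f t"
proof
  define sl where "sl t = insert 0 ((\<lambda>s. (f s - f t) / (s - t)) ` {s \<in> P. t < s})" for t
  define g where "g t = Min (sl t)" for t
  have fin: "finite (sl t)" for t
    using \<open>finite P\<close> by (simp add: sl_def)
  show "g t \<le> 0" for t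
    unfolding g_def using fin by (rule Min_le) (simp add: sl_def)
  show "g t * (s - t) \<le> f s - f t" if st: "s \<in> P" "t \<in> P" for s t
  proof (cases s t rule: linorder_cases)
    case less
    have "(f t - f s) / (t - s) \<le> z" if z_in: "z \<in> sl t" for z
    proof (cases "z = 0")
      case True
      have "f t \<le> f s"
        using monotone_onD[OF assms(2), of s t] less st \<open>P \<subseteq> D\<close> by auto
      then show ?thesis
        using less True by (simp add: divide_nonpos_pos)
    next
      case False
      then obtain u where u: "u \<in> P" "t < u" and z: "z = (f u - f t) / (u - t)"
        using z_in by (auto simp: sl_def)
      have "(f s - f t) / (s - t) \<le> (f s - f u) / (s - u)"
        and "(f s - f u) / (s - u) \<le> (f t - f u) / (t - u)"
        using convex_on_slope_le[OF assms(1), of s u t] less u st \<open>P \<subseteq> D\<close> by auto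
      then show ?thesis
        using z by (smt (verit) minus_diff_eq minus_divide_divide)
    qed
    then have "(f t - f s) / (t - s) \<le> g t"
      unfolding g_def using fin by (intro Min.boundedI) (auto simp: sl_def)
    then show ?thesis
      using less by (simp add: field_simps)
  next
    case equal
    then show ?thesis by simp
  next
    case greater
    have "g t \<le> (f s - f t) / (s - t)"
      unfolding g_def using fin by (rule Min_le) (use greater st in \<open>auto simp: sl_def\<close>)
    then show ?thesis
      using greater by (simp add: field_simps)
  qed
qed

lemma sum_mult_nonneg_by_parts:
  fixes c d :: "nat \<Rightarrow> real"
  assumes incr: "\<And>i. Suc i < n \<Longrightarrow> c i \<le> c (Suc i)"
    and nonpos: "\<And>i. i < n \<Longrightarrow> c i \<le> 0"
    and partial: "\<And>k. k \<in> {1..n} \<Longrightarrow> (\<Sum>i<k. d i) \<le> 0"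
  shows "0 \<le> (\<Sum>i<n. c i * d i)"
proof (cases n)
  case (Suc p)
  \<comment> \<open>The induction replaces all coefficients by the last one: raising \<open>c k\<close> to \<open>c (Suc k)\<close>
    can only lower its product with a non-positive partial sum.\<close>
  have "c k * (\<Sum>i<Suc k. d i) \<le> (\<Sum>i<Suc k. c i * d i)" if "k < n" for k
    using that
  proof (induction k)
    case (Suc k)
    have "c (Suc k) * (\<Sum>i<Suc k. d i) \<le> c k * (\<Sum>i<Suc k. d i)"
      using Suc.prems incr[of k] partial[of "Suc k"] by (intro mult_right_mono_neg) auto
    also have "\<dots> \<le> (\<Sum>i<Suc k. c i * d i)"
      using Suc by simp
    finally show ?case
      by (simp add: distrib_left)
  qed simp
  from this[of p] have "c p * (\<Sum>i<n. d i) \<le> (\<Sum>i<n. c i * d i)"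
    using Suc by simp
  moreover have "0 \<le> c p * (\<Sum>i<n. d i)"
    using Suc nonpos[of p] partial[of n] by (intro mult_nonpos_nonpos) auto
  ultimately show ?thesis by linarith
qed simp

lemma sum_list_map_sort:
  fixes f :: "'a::linorder \<Rightarrow> 'b::comm_monoid_add"
  shows "sum_list (map f A) = (\<Sum>i<length A. f (sort A ! i))"
proof -
  have "sum_list (map f A) = sum_list (map f (sort A))"
    by (metis mset_map mset_sort sum_mset_sum_list)
  also have "\<dots> = (\<Sum>i<length A. f (sort A ! i))"
    by (simp add: sum_list_sum_nth atLeast0LessThan)
  finally show ?thesis .
qed

lemma majorizes_imp_sum_list_convex_le:
  assumes conv: "convex_on D f" and anti: "antimono_on D f"
    and A: "set A \<subseteq> D" and B: "set B \<subseteq> D" and maj: "A \<rhd> B"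
  shows "sum_list (map f A) \<le> sum_list (map f B)"
proof -
  define n where "n = length A"
  define a where "a i = sort A ! i" for i
  define b where "b i = sort B ! i" for i
  have len: "length B = n"
    using maj by (simp add: majorizes_def n_def)
  have a_in: "a i \<in> set A \<union> set B" and b_in: "b i \<in> set A \<union> set B" if "i < n" for i
    using that nth_mem[of i "sort A"] nth_mem[of i "sort B"] len
    by (auto simp: a_def b_def n_def)
  obtain g where g_nonpos: "\<And>t. g t \<le> 0"
    and g_sub: "\<And>s t. s \<in> set A \<union> set B \<Longrightarrow> t \<in> set A \<union> set B
      \<Longrightarrow> g t * (s - t) \<le> f s - f t"
    using finite_nonpos_subgradient[OF conv anti, of "set A \<union> set B"] A B by auto
  have g_mono: "g s \<le> g t" if "s \<in> set A \<union> set B" "t \<in> set A \<union> set B" "s \<le> t" for s t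
  proof (cases "s = t")
    case False
    \<comment> \<open>Adding the subgradient inequalities at \<open>s\<close> and at \<open>t\<close> eliminates \<open>f\<close>.\<close>
    have "g s * (t - s) \<le> g t * (t - s)"
      using g_sub[of s t] g_sub[of t s] that by (simp add: algebra_simps)
    then show ?thesis
      using False that by simp
  qed simp
  have "0 \<le> (\<Sum>i<n. g (a i) * (b i - a i))"
  proof (rule sum_mult_nonneg_by_parts)
    show "g (a i) \<le> g (a (Suc i))" if "Suc i < n" for i
      using that by (intro g_mono a_in) (auto simp: a_def n_def intro!: sorted_nth_mono)
    show "g (a i) \<le> 0" for i
      by (rule g_nonpos)
    show "(\<Sum>i<k. b i - a i) \<le> 0" if "k \<in> {1..n}" for k
      using maj that by (simp add: majorizes_def a_def b_def n_def sum_subtractf)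
  qed
  also have "\<dots> \<le> (\<Sum>i<n. f (b i) - f (a i))"
    by (intro sum_mono g_sub a_in b_in) auto
  finally have "(\<Sum>i<n. f (a i)) \<le> (\<Sum>i<n. f (b i))"
    by (simp add: sum_subtractf)
  then show ?thesis
    using len by (simp add: sum_list_map_sort a_def b_def n_def)
qed

lemma sum_list_concat_eq: "sum_list (concat xss) = (\<Sum>xs\<leftarrow>xss. sum_list xs)"
  by (induction xss) simp_all

lemma energy_eq_sum_list: "energy \<rho> f m x = sum_list (map f (R_seq \<rho> m x))"
proof -
  have "{(i, j). 1 \<le> i \<and> i < j \<and> j \<le> m} = (SIGMA i:{1..<Suc m}. {Suc i..<Suc m})"
    by auto
  then have "energy \<rho> f m x = (\<Sum>i = 1..<Suc m. \<Sum>j = Suc i..<Suc m. f (\<rho> (x i) (x j)))"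
    unfolding energy_def by (simp add: sum.Sigma del: One_nat_def sum.op_ivl_Suc)
  also have "\<dots> = sum_list (map f (R_seq \<rho> m x))"
    by (simp add: R_seq_def map_concat sum_list_concat_eq comp_def sum_list_distinct_conv_sum_set
        del: upt_Suc)
  finally show ?thesis .
qed

lemma set_R_seq_subset:
  assumes "\<And>s t. s \<in> S \<Longrightarrow> t \<in> S \<Longrightarrow> \<rho> s t \<in> D" and "bij_betw x {1..m} X" and "X \<subseteq> S"
  shows "set (R_seq \<rho> m x) \<subseteq> D"
proof -
  have "x i \<in> S" if "i \<in> {1..m}" for i
    using assms(2,3) that bij_betwE by blast
  then show ?thesis
    by (auto simp: R_seq_def intro!: assms(1))
qed

theorem theorem2p1:
  fixes S X Y :: "'s set" and D :: "real set" and \<rho> :: "'s \<Rightarrow> 's \<Rightarrow> real"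
    and m :: nat and x y :: "nat \<Rightarrow> 's" and f :: "real \<Rightarrow> real"
  assumes "is_interval D"
    and "\<And>s t. s \<in> S \<Longrightarrow> t \<in> S \<Longrightarrow> \<rho> s t \<in> D"
    and "\<And>s t. s \<in> S \<Longrightarrow> t \<in> S \<Longrightarrow> \<rho> s t = \<rho> t s"
    and "m \<ge> 2"
    and "X \<subseteq> S" and "card X = m" and "bij_betw x {1..m} X"
    and "Y \<subseteq> S" and "card Y = m" and "bij_betw y {1..m} Y"
    and "R_seq \<rho> m x \<rhd> R_seq \<rho> m y"
    and "convex_on D f" and "antimono_on D f"
  shows "energy \<rho> f m x \<le> energy \<rho> f m y"
  unfolding energy_eq_sum_list
  using assms(12,13) set_R_seq_subset[OF assms(2,7,5)] set_R_seq_subset[OF assms(2,10,8)]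
    assms(11)
  by (rule majorizes_imp_sum_list_convex_le)

end
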